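(* \[ {\bf B}_1^k = \sum_{i=0}^n (pi)^k {\bf e}_i, \quad k=0, 1,\ldots, \] where ${\bf e}_i =\frac{1}{i!} \sum_{a=i}^{n}\frac{(-1)^{a-i}}{p^a(a-i)!}{\bf B}_a$ for $i=0,1,\ldots,n$.
   Context: $G_{n,p}=C_p\wr\mathfrak S_n$ is the colored permutation group (pairs $(s,\sigma)$, $s\in C_p^n$, $\sigma\in\mathfrak S_n$, product $(t,\tau)(s,\sigma)=(\sigma t+s,\tau\sigma)$, $\sigma t=(t_{\sigma(1)},\ldots,t_{\sigma(n)})$), whose elements are regarded as words $(s_1,\sigma(1))\cdots(s_n,\sigma(n))$ over $C_p\times[n]$. For words $u,v$, $u\sqcup\!\sqcup v$ is the shuffle product (formal sum of all interleavings). Let $W_{k,n}=(0,k+1)(0,k+2)\cdots(0,n)$ and define in ${\mathbb Q}G_{n,p}$: ${\mathbf B}_0=id$, ${\mathbf B}_k=\sum_{\alpha\in G_{k,p}}\alpha\sqcup\!\sqcup W_{k,n}$ for $1\le k\le n-1$, ${\mathbf B}_n=\sum_{\alpha\in G_{n,p}}\alpha$. *)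

theory Defs
  imports "HOL-Algebra.Algebra" "HOL-Library.Multiset"
begin

text \<open>
  \<open>C\<^sub>p\<close> is \<^const>\<open>integer_mod_group\<close> (additive residues \<open>{0..<p}\<close>, for \<open>p \<ge> 1\<close>), \<open>C\<^sub>p\<^sup>n\<close> consists of
  functions on \<open>{1..n}\<close> that are \<^const>\<open>undefined\<close> elsewhere, and permutations of \<open>[n]\<close> are
  functions on all naturals that fix everything outside \<open>{1..n}\<close>.
\<close>

definition colored_perm_group :: "nat \<Rightarrow> nat \<Rightarrow> ((nat \<Rightarrow> int) \<times> (nat \<Rightarrow> nat)) monoid" where
  "colored_perm_group n p =
     (let C = product_group {1..n} (\<lambda>_. integer_mod_group p) in
      \<lparr> carrier = carrier C \<times> carrier (sym_group n),
        monoid.mult = (\<lambda>(t, \<tau>) (s, \<sigma>). ((\<lambda>i\<in>{1..n}. t (\<sigma> i)) \<otimes>\<^bsub>C\<^esub> s, \<tau> \<otimes>\<^bsub>sym_group n\<^esub> \<sigma>)),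
        one = (\<one>\<^bsub>C\<^esub>, \<one>\<^bsub>sym_group n\<^esub>) \<rparr>)"

definition word_of :: "nat \<Rightarrow> (nat \<Rightarrow> int) \<times> (nat \<Rightarrow> nat) \<Rightarrow> (int \<times> nat) list" where
  "word_of n = (\<lambda>(s, \<sigma>). map (\<lambda>i. (s i, \<sigma> i)) [1..<Suc n])"

text \<open>
  The rational group algebra: finitely supported functions on the group, extended by \<open>0\<close> outside
  its carrier, with convolution as multiplication.
\<close>

definition rat_group_algebra :: "('g, 'm) monoid_scheme \<Rightarrow> (rat, 'g \<Rightarrow> rat) module" where
  "rat_group_algebra G =
     \<lparr> carrier = {f. finite {x. f x \<noteq> 0} \<and> {x. f x \<noteq> 0} \<subseteq> carrier G},
       monoid.mult = (\<lambda>f g x. \<Sum>(y, z) | f y \<noteq> 0 \<and> g z \<noteq> 0 \<and> y \<otimes>\<^bsub>G\<^esub> z = x. f y * g z),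
       one = (\<lambda>x. if x = \<one>\<^bsub>G\<^esub> then 1 else 0),
       ring.zero = (\<lambda>x. 0),
       add = (\<lambda>f g x. f x + g x),
       smult = (\<lambda>c f x. c * f x) \<rparr>"

text \<open>
  Formal sums of words with natural number coefficients are multisets of words. The library's
  \<^const>\<open>shuffles\<close> is only the underlying set of the shuffle product.
\<close>

fun shuffle_product :: "'a list \<Rightarrow> 'a list \<Rightarrow> 'a list multiset" where
  "shuffle_product [] v = {#v#}"
| "shuffle_product u [] = {#u#}"
| "shuffle_product (a # u) (b # v) =
     image_mset (Cons a) (shuffle_product u (b # v)) +
     image_mset (Cons b) (shuffle_product (a # u) v)"

lemma set_mset_shuffle_product: "set_mset (shuffle_product u v) = shuffles u v"
  by (induction u v rule: shuffle_product.induct) auto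

lemma size_shuffle_product:
  "size (shuffle_product u v) = (length u + length v) choose length u"
  by (induction u v rule: shuffle_product.induct) auto

text \<open>
  A formal sum of words of colored permutations, read as an element of the group algebra:
  the coefficient of a group element is the multiplicity of its word.
\<close>

definition of_words ::
  "nat \<Rightarrow> nat \<Rightarrow> (int \<times> nat) list multiset \<Rightarrow> (nat \<Rightarrow> int) \<times> (nat \<Rightarrow> nat) \<Rightarrow> rat" where
  "of_words n p M =
     (\<lambda>x. if x \<in> carrier (colored_perm_group n p) then of_nat (count M (word_of n x)) else 0)"

definition W_word :: "nat \<Rightarrow> nat \<Rightarrow> (int \<times> nat) list" where
  "W_word k n = map (\<lambda>j. (0, j)) [Suc k..<Suc n]"

definition B_elt :: "nat \<Rightarrow> nat \<Rightarrow> nat \<Rightarrow> (nat \<Rightarrow> int) \<times> (nat \<Rightarrow> nat) \<Rightarrow> rat" where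
  "B_elt n p k =
     (if k = 0 then \<one>\<^bsub>rat_group_algebra (colored_perm_group n p)\<^esub>
      else if k < n then of_words n p
        (\<Sum>\<alpha>\<in>carrier (colored_perm_group k p). shuffle_product (word_of k \<alpha>) (W_word k n))
      else of_words n p (\<Sum>\<alpha>\<in>carrier (colored_perm_group n p). {#word_of n \<alpha>#}))"

definition e_elt :: "nat \<Rightarrow> nat \<Rightarrow> nat \<Rightarrow> (nat \<Rightarrow> int) \<times> (nat \<Rightarrow> nat) \<Rightarrow> rat" where
  "e_elt n p i =
     (let A = rat_group_algebra (colored_perm_group n p) in
      (1 / fact i) \<odot>\<^bsub>A\<^esub>
        (\<Oplus>\<^bsub>A\<^esub>a\<in>{i..n}. ((-1) ^ (a - i) / (of_nat p ^ a * fact (a - i))) \<odot>\<^bsub>A\<^esub> B_elt n p a))"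

lemma group_colored_perm_group: "group (colored_perm_group n p)"
proof -
  define C where "C = product_group {1..n} (\<lambda>_. integer_mod_group p)"
  interpret C: group C unfolding C_def by simp
  define act where "act t \<sigma> = (\<lambda>i\<in>{1..n}. t (\<sigma> i))" for t :: "nat \<Rightarrow> int" and \<sigma> :: "nat \<Rightarrow> nat"
  have cl: "act t \<sigma> \<in> carrier C" if "t \<in> carrier C" "\<sigma> permutes {1..n}" for t \<sigma>
    using that permutes_in_image[of \<sigma> "{1..n}"] unfolding act_def C_def by (force simp: PiE_iff)
  have hom: "act (t \<otimes>\<^bsub>C\<^esub> s) \<sigma> = act t \<sigma> \<otimes>\<^bsub>C\<^esub> act s \<sigma>" if "\<sigma> permutes {1..n}" for t s \<sigma>
    using permutes_in_image[OF that] unfolding act_def C_def by (auto simp: fun_eq_iff restrict_def)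
  have comp: "act (act t \<tau>) \<sigma> = act t (\<tau> \<circ> \<sigma>)" if "\<sigma> permutes {1..n}" for t \<tau> \<sigma>
    using permutes_in_image[OF that] unfolding act_def by (auto simp: fun_eq_iff restrict_def)
  have ac1: "act \<one>\<^bsub>C\<^esub> \<sigma> = \<one>\<^bsub>C\<^esub>" if "\<sigma> permutes {1..n}" for \<sigma>
    using permutes_in_image[OF that] unfolding act_def C_def by (auto simp: fun_eq_iff restrict_def)
  have G: "colored_perm_group n p =
      \<lparr> carrier = carrier C \<times> {\<sigma>. \<sigma> permutes {1..n}},
        monoid.mult = (\<lambda>(t, \<tau>) (s, \<sigma>). (act t \<sigma> \<otimes>\<^bsub>C\<^esub> s, \<tau> \<circ> \<sigma>)), one = (\<one>\<^bsub>C\<^esub>, id) \<rparr>"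
    unfolding colored_perm_group_def Let_def C_def[symmetric] act_def[symmetric] sym_group_def
    by simp
  have act_id: "act t id = t" if "t \<in> carrier C" for t
    using that unfolding act_def C_def by (auto simp: PiE_iff extensional_def fun_eq_iff)
  show ?thesis
  proof (rule groupI, goal_cases)
    case 4
    then show ?case by (auto simp: G ac1)
  next
    case (5 x)
    then obtain s \<sigma> where x: "x = (s, \<sigma>)" "s \<in> carrier C" "\<sigma> permutes {1..n}"
      by (auto simp: G)
    let ?t = "act (inv\<^bsub>C\<^esub> s) (Hilbert_Choice.inv \<sigma>)"
    have "(?t, Hilbert_Choice.inv \<sigma>) \<in> carrier (colored_perm_group n p)"
      using x cl by (auto simp: G permutes_inv)
    moreover have "act ?t \<sigma> = inv\<^bsub>C\<^esub> s"
      using x by (simp add: comp permutes_inv_o act_id)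
    ultimately show ?case
      using x by (intro bexI[of _ "(?t, Hilbert_Choice.inv \<sigma>)"]) (auto simp: G permutes_inv_o)
  qed (auto simp: G cl hom comp permutes_compose permutes_id C.m_assoc comp_assoc)
qed

lemma abelian_group_rat_group_algebra: "abelian_group (rat_group_algebra G)"
proof (rule abelian_groupI, goal_cases)
  case (1 f g)
  have "{x. f x + g x \<noteq> 0} \<subseteq> {x. f x \<noteq> 0} \<union> {x. g x \<noteq> 0}" by auto
  with 1 show ?case
    by (auto simp: rat_group_algebra_def intro: finite_subset)
next
  case (6 f)
  then show ?case
    by (intro bexI[of _ "\<lambda>x. - f x"]) (auto simp: rat_group_algebra_def)
qed (auto simp: rat_group_algebra_def)

end

theory Submission
  imports Defs
begin

text \<open>
  \<open>B\<^sub>a\<close> is the indicator function of the colored permutations whose word has the letters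
  \<open>(0, a + 1), \<dots>, (0, n)\<close> in this order, up to letters with values at most \<open>a\<close>. Counting the
  factorizations of a colored permutation gives \<open>B\<^sub>a B\<^sub>1 = p a B\<^sub>a + B\<^sub>a\<^sub>+\<^sub>1\<close>, without the second summand
  if \<open>a = n\<close>. Hence the \<open>e\<^sub>i\<close> are eigenvectors of right multiplication by \<open>B\<^sub>1\<close> with eigenvalues
  \<open>p i\<close>, and they sum up to \<open>1\<close> because alternating sums of binomial coefficients vanish.
\<close>

section \<open>The group algebra\<close>

text \<open>Addition in the algebra is pointwise, so sums in it can be computed as rational sums at
  each \<open>x\<close>. For infinite \<open>I\<close> both sides take their default value
  zero.\<close>

lemma finsum_rat_group_algebra:
  assumes "F \<in> I \<rightarrow> carrier (rat_group_algebra G)"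
  shows "finsum (rat_group_algebra G) F I = (\<lambda>x. \<Sum>i\<in>I. F i x)"
proof -
  interpret abelian_group "rat_group_algebra G" by (rule abelian_group_rat_group_algebra)
  show ?thesis
    using assms
  proof (induction I rule: infinite_finite_induct)
    case (insert i I)
    then show ?case by (simp add: Pi_iff) (simp add: rat_group_algebra_def)
  qed (simp_all, simp_all add: rat_group_algebra_def)
qed

lemma smult_rat_group_algebra: "c \<odot>\<^bsub>rat_group_algebra G\<^esub> f = (\<lambda>x. c * f x)"
  by (simp add: rat_group_algebra_def)

lemma smult_closed_rat_group_algebra:
  "f \<in> carrier (rat_group_algebra G) \<Longrightarrow> c \<odot>\<^bsub>rat_group_algebra G\<^esub> f \<in> carrier (rat_group_algebra G)"
  by (auto simp: rat_group_algebra_def elim: rev_finite_subset)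

lemma support_sum_subset:
  fixes c :: "_ \<Rightarrow> rat"
  shows "{x. (\<Sum>i\<in>I. c i * f i x) \<noteq> 0} \<subseteq> (\<Union>i\<in>I. {x. f i x \<noteq> 0})"
  by (rule subsetI, rule ccontr) simp

lemma sum_closed_rat_group_algebra:
  assumes "\<And>i. i \<in> I \<Longrightarrow> f i \<in> carrier (rat_group_algebra G)"
  shows "(\<lambda>x. \<Sum>i\<in>I. c i * f i x) \<in> carrier (rat_group_algebra G)"
proof (cases "finite I")
  case True
  have "finite (\<Union>i\<in>I. {x. f i x \<noteq> 0})" "(\<Union>i\<in>I. {x. f i x \<noteq> 0}) \<subseteq> carrier G"
    using True assms by (auto simp: rat_group_algebra_def)
  with support_sum_subset[where I = I and c = c and f = f] show ?thesis
    unfolding rat_group_algebra_def by (auto intro: finite_subset)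
qed (simp add: rat_group_algebra_def)

text \<open>Enlarging the supports to \<open>Y\<close> and \<open>Z\<close> adds only zero terms.
  The index set then no longer depends on \<open>f\<close> and \<open>g\<close>, as linearity
  arguments require.\<close>

lemma mult_rat_group_algebra:
  assumes "finite Y" "finite Z" "{y. f y \<noteq> 0} \<subseteq> Y" "{z. g z \<noteq> 0} \<subseteq> Z"
  shows "(f \<otimes>\<^bsub>rat_group_algebra G\<^esub> g) x =
    (\<Sum>(y, z) \<in> {(y, z) \<in> Y \<times> Z. y \<otimes>\<^bsub>G\<^esub> z = x}. f y * g z)"
  unfolding rat_group_algebra_def
  by (simp, rule sum.mono_neutral_left)
    (use assms in \<open>auto intro: finite_subset[of _ "Y \<times> Z"]\<close>)

lemma sum_mult_rat_group_algebra:
  assumes "finite I" "\<And>i. i \<in> I \<Longrightarrow> f i \<in> carrier (rat_group_algebra G)"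
    and "g \<in> carrier (rat_group_algebra G)"
  shows "(\<lambda>x. \<Sum>i\<in>I. c i * f i x) \<otimes>\<^bsub>rat_group_algebra G\<^esub> g =
    (\<lambda>x. \<Sum>i\<in>I. c i * (f i \<otimes>\<^bsub>rat_group_algebra G\<^esub> g) x)"
proof
  fix x
  \<comment> \<open>Since \<open>Y\<close> contains all the supports, the convolution of each
    \<open>f i\<close> and that of the linear combination run over the same pairs, and the sums can
    be swapped.\<close>
  define Y where "Y = (\<Union>i\<in>I. {y. f i y \<noteq> 0})"
  define Z where "Z = {z. g z \<noteq> 0}"
  have fin: "finite Y" "finite Z"
    using assms by (auto simp: Y_def Z_def rat_group_algebra_def)
  have mult: "(h \<otimes>\<^bsub>rat_group_algebra G\<^esub> g) x =
      (\<Sum>(y, z) \<in> {(y, z) \<in> Y \<times> Z. y \<otimes>\<^bsub>G\<^esub> z = x}. h y * g z)" if "{y. h y \<noteq> 0} \<subseteq> Y" for h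
    by (rule mult_rat_group_algebra) (use fin that in \<open>auto simp: Z_def\<close>)
  have "{y. (\<Sum>i\<in>I. c i * f i y) \<noteq> 0} \<subseteq> Y"
    unfolding Y_def by (rule support_sum_subset)
  then have "((\<lambda>x. \<Sum>i\<in>I. c i * f i x) \<otimes>\<^bsub>rat_group_algebra G\<^esub> g) x =
      (\<Sum>(y, z) \<in> {(y, z) \<in> Y \<times> Z. y \<otimes>\<^bsub>G\<^esub> z = x}. (\<Sum>i\<in>I. c i * f i y) * g z)"
    by (rule mult)
  also have "\<dots> = (\<Sum>i\<in>I. c i * (\<Sum>(y, z) \<in> {(y, z) \<in> Y \<times> Z. y \<otimes>\<^bsub>G\<^esub> z = x}. f i y * g z))"
    unfolding sum_distrib_left sum_distrib_right case_prod_unfold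
    by (subst sum.swap) (simp add: mult.assoc)
  also have "\<dots> = (\<Sum>i\<in>I. c i * (f i \<otimes>\<^bsub>rat_group_algebra G\<^esub> g) x)"
    by (intro sum.cong refl, subst mult) (auto simp: Y_def)
  finally show "((\<lambda>x. \<Sum>i\<in>I. c i * f i x) \<otimes>\<^bsub>rat_group_algebra G\<^esub> g) x =
      (\<Sum>i\<in>I. c i * (f i \<otimes>\<^bsub>rat_group_algebra G\<^esub> g) x)" .
qed

section \<open>Colored permutations as words\<close>

lemma carrier_colored_perm_group:
  assumes "p \<ge> 1"
  shows "carrier (colored_perm_group n p) =
    ({1..n} \<rightarrow>\<^sub>E {0..<int p}) \<times> {\<sigma>. \<sigma> permutes {1..n}}"
  using assms
  by (simp add: colored_perm_group_def Let_def sym_group_def carrier_integer_mod_group)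

lemma one_colored_perm_group: "\<one>\<^bsub>colored_perm_group n p\<^esub> = (\<lambda>i\<in>{1..n}. 0, id)"
  by (simp add: colored_perm_group_def Let_def sym_group_def)

lemma finite_colored_perm_group: "p \<ge> 1 \<Longrightarrow> finite (carrier (colored_perm_group n p))"
  by (simp add: carrier_colored_perm_group finite_PiE finite_permutations)

text \<open>Length \<open>n\<close> and value set \<open>{1..n}\<close> together force every value
  to occur exactly once.\<close>

definition colored_words :: "nat \<Rightarrow> nat \<Rightarrow> (int \<times> nat) list set" where
  "colored_words n p =
    {w. length w = n \<and> fst ` set w \<subseteq> {0..<int p} \<and> snd ` set w = {1..n}}"

lemma distinct_colored_words: "w \<in> colored_words n p \<Longrightarrow> distinct (map snd w)"
  by (intro card_distinct) (simp add: colored_words_def)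

lemma word_of_nth: "i < n \<Longrightarrow> word_of n x ! i = (fst x (Suc i), snd x (Suc i))"
  by (simp add: word_of_def case_prod_unfold del: upt_Suc)

lemma length_word_of [simp]: "length (word_of n x) = n"
  by (simp add: word_of_def case_prod_unfold del: upt_Suc)

text \<open>Outside \<open>{1..n}\<close> the carrier prescribes both components
  (\<open>undefined\<close> for the coloring, the identity for the permutation), so an element is
  determined by its letters.\<close>

lemma bij_betw_word_of:
  assumes "p \<ge> 1"
  shows "bij_betw (word_of n) (carrier (colored_perm_group n p)) (colored_words n p)"
  unfolding bij_betw_def
proof (intro conjI inj_onI subset_antisym subsetI)
  fix x y
  assume xy: "x \<in> carrier (colored_perm_group n p)" "y \<in> carrier (colored_perm_group n p)"
    and eq: "word_of n x = word_of n y"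
  have on: "fst x i = fst y i \<and> snd x i = snd y i" if "i \<in> {1..n}" for i
  proof -
    from that obtain j where "i = Suc j" "j < n" by (cases i) auto
    then show ?thesis using arg_cong[OF eq, of "\<lambda>w. w ! j"] by (simp add: word_of_nth)
  qed
  have "fst x = fst y"
    using xy on by (intro PiE_ext[of _ "{1..n}"]) (auto simp: carrier_colored_perm_group[OF assms])
  moreover have "snd x i = snd y i" for i
    using xy on[of i] by (cases "i \<in> {1..n}")
      (auto simp: carrier_colored_perm_group[OF assms] permutes_not_in)
  ultimately show "x = y" by (simp add: prod_eq_iff fun_eq_iff)
next
  fix w assume "w \<in> word_of n ` carrier (colored_perm_group n p)"
  then obtain s \<sigma> where w: "w = word_of n (s, \<sigma>)"
    and s: "s \<in> {1..n} \<rightarrow>\<^sub>E {0..<int p}" and \<sigma>: "\<sigma> permutes {1..n}"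
    by (auto simp: carrier_colored_perm_group[OF assms])
  have "set w = (\<lambda>i. (s i, \<sigma> i)) ` {1..n}"
    by (simp add: w word_of_def atLeastLessThanSuc_atLeastAtMost del: upt_Suc)
  then show "w \<in> colored_words n p"
    using s permutes_image[OF \<sigma>] by (auto simp: w colored_words_def image_image)
next
  fix w assume w: "w \<in> colored_words n p"
  then have len: "length w = n" and setw: "snd ` set w = {1..n}"
    and col: "fst ` set w \<subseteq> {0..<int p}"
    by (auto simp: colored_words_def)
  \<comment> \<open>The inverse map: list indices start at 0 and positions at 1, and outside
    \<open>{1..n}\<close> the prescribed values are filled in.\<close>
  define s where "s = (\<lambda>i\<in>{1..n}. fst (w ! (i - 1)))"
  define \<sigma> where "\<sigma> i = (if i \<in> {1..n} then snd (w ! (i - 1)) else i)" for i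
  have "\<sigma> ` {1..n} = snd ` set w"
  proof -
    have "{1..n} = Suc ` {..<n}" by (simp add: image_Suc_lessThan)
    then have "\<sigma> ` {1..n} = (\<lambda>i. snd (w ! i)) ` {..<n}" by (auto simp: \<sigma>_def image_image)
    also have "\<dots> = snd ` set w" using len by (auto simp: set_conv_nth)
    finally show ?thesis .
  qed
  then have "bij_betw \<sigma> {1..n} {1..n}"
    unfolding setw by (simp add: bij_betw_def eq_card_imp_inj_on)
  then have "\<sigma> permutes {1..n}" by (rule bij_imp_permutes) (auto simp: \<sigma>_def)
  moreover have "s \<in> {1..n} \<rightarrow>\<^sub>E {0..<int p}"
  proof (rule PiE_I)
    fix i assume "i \<in> {1..n}"
    then have "fst (w ! (i - 1)) \<in> fst ` set w" using len by (intro imageI nth_mem) auto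
    then show "s i \<in> {0..<int p}" using col \<open>i \<in> {1..n}\<close> by (auto simp: s_def)
  qed (auto simp: s_def)
  moreover have "word_of n (s, \<sigma>) = w"
    by (rule nth_equalityI) (auto simp: len word_of_nth s_def \<sigma>_def)
  ultimately show "w \<in> word_of n ` carrier (colored_perm_group n p)"
    by (intro image_eqI[of _ _ "(s, \<sigma>)"]) (auto simp: carrier_colored_perm_group[OF assms])
qed

text \<open>The action of a group element on single letters that underlies left
  multiplication.\<close>

definition relabel :: "nat \<Rightarrow> (nat \<Rightarrow> int) \<times> (nat \<Rightarrow> nat) \<Rightarrow> int \<times> nat \<Rightarrow> int \<times> nat" where
  "relabel p x = (\<lambda>(c, i). ((fst x i + c) mod int p, snd x i))"

text \<open>At position \<open>i\<close> the product of \<open>(t, \<tau>)\<close> and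
  \<open>(s, \<sigma>)\<close> has color \<open>t (\<sigma> i) + s i\<close> and value
  \<open>\<tau> (\<sigma> i)\<close>, which depend on \<open>i\<close> only through the letter
  \<open>(s i, \<sigma> i)\<close>.\<close>

lemma word_of_mult:
  assumes "p \<ge> 1" "x \<in> carrier (colored_perm_group n p)" "y \<in> carrier (colored_perm_group n p)"
  shows "word_of n (x \<otimes>\<^bsub>colored_perm_group n p\<^esub> y) = map (relabel p x) (word_of n y)"
proof (rule nth_equalityI)
  fix i assume "i < length (word_of n (x \<otimes>\<^bsub>colored_perm_group n p\<^esub> y))"
  then have "i < n" by simp
  moreover from this have "snd y (Suc i) \<in> {1..n}"
    using assms(3) permutes_in_image[of "snd y" "{1..n}" "Suc i"]
    by (auto simp: carrier_colored_perm_group[OF assms(1)])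
  ultimately show "word_of n (x \<otimes>\<^bsub>colored_perm_group n p\<^esub> y) ! i =
      map (relabel p x) (word_of n y) ! i"
    using assms(1)
    by (simp add: word_of_nth relabel_def colored_perm_group_def Let_def sym_group_def
        case_prod_unfold integer_mod_group_def)
qed simp

lemma W_word_Cons: "k < n \<Longrightarrow> W_word k n = (0, Suc k) # W_word (Suc k) n"
  by (simp add: W_word_def upt_rec del: upt_Suc)

lemma word_of_one: "word_of n \<one>\<^bsub>colored_perm_group n p\<^esub> = W_word 0 n"
  by (auto simp: one_colored_perm_group word_of_def W_word_def simp del: upt_Suc)

text \<open>The value is recovered because \<open>snd x\<close> is injective, and then the color
  because a translation modulo \<open>p\<close> can be undone on reduced residues.\<close>

lemma inj_on_relabel:
  assumes "p \<ge> 1" "x \<in> carrier (colored_perm_group n p)"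
  shows "inj_on (relabel p x) ({0..<int p} \<times> {1..n})"
proof (rule inj_onI)
  fix l l' assume l: "l \<in> {0..<int p} \<times> {1..n}" "l' \<in> {0..<int p} \<times> {1..n}"
    and eq: "relabel p x l = relabel p x l'"
  have "inj (snd x)"
    using assms(2) by (auto simp: carrier_colored_perm_group[OF assms(1)] intro: permutes_inj)
  then have snd: "snd l = snd l'"
    using eq by (auto simp: relabel_def case_prod_unfold dest: injD)
  then have "(fst x (snd l) + fst l) mod int p = (fst x (snd l) + fst l') mod int p"
    using eq by (simp add: relabel_def case_prod_unfold)
  then have "fst l mod int p = fst l' mod int p"
    by (metis mod_diff_left_eq add_diff_cancel_left')
  then show "l = l'" using l snd by (auto simp: prod_eq_iff)
qed

section \<open>The elements \<open>B\<^sub>k\<close> as indicator functions\<close>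

text \<open>With disjoint alphabets the first letter of an interleaving tells which word it comes
  from, so no interleaving arises twice.\<close>

lemma count_shuffle_product_disjoint:
  assumes "set u \<inter> set v = {}"
  shows "count (shuffle_product u v) w = (if w \<in> shuffles u v then 1 else 0)"
  using assms
proof (induction u v arbitrary: w rule: shuffle_product.induct)
  case (3 a u b v)
  have cnt: "count (image_mset (Cons c) M) w =
      (case w of [] \<Rightarrow> 0 | d # w' \<Rightarrow> if d = c then count M w' else 0)" for c :: 'a and M
    by (induction M) (auto split: list.split)
  show ?case
    using 3 by (auto simp: cnt Cons_in_shuffles_iff split: list.split)
qed auto

text \<open>One description for all three cases of \<open>B_elt\<close>: \<open>a = 0\<close> leaves
  only the identity, and for \<open>a = n\<close> two empty words are compared.\<close>

definition shuffle_set :: "nat \<Rightarrow> nat \<Rightarrow> nat \<Rightarrow> ((nat \<Rightarrow> int) \<times> (nat \<Rightarrow> nat)) set" where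
  "shuffle_set n p a = {x \<in> carrier (colored_perm_group n p).
     filter (\<lambda>l. snd l > a) (word_of n x) = W_word a n}"

text \<open>A word in the shuffle of \<open>\<alpha>\<close> with \<open>W_word a n\<close>
  determines \<open>\<alpha>\<close> as its subword of values at most \<open>a\<close>, and the
  interleaving is unique; hence all coefficients are 0 or 1.\<close>

lemma B_elt_eq_indicator:
  assumes "p \<ge> 1" "a \<le> n"
  shows "B_elt n p a = (\<lambda>x. if x \<in> shuffle_set n p a then 1 else 0)"
proof
  fix x
  have word_in: "word_of m y \<in> colored_words m p"
    if "y \<in> carrier (colored_perm_group m p)" for m y
    using bij_betwE[OF bij_betw_word_of] assms(1) that by blast
  then have letters_in: "snd l \<in> {1..m}"
    if "y \<in> carrier (colored_perm_group m p)" "l \<in> set (word_of m y)" for m y l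
    using that unfolding colored_words_def by blast
  have inj: "inj_on (word_of m) (carrier (colored_perm_group m p))" for m
    using bij_betw_imp_inj_on[OF bij_betw_word_of] assms(1) .
  have fin: "finite (carrier (colored_perm_group m p))" for m
    using assms(1) by (rule finite_colored_perm_group)
  have one: "\<one>\<^bsub>colored_perm_group n p\<^esub> \<in> carrier (colored_perm_group n p)"
    by (intro group.is_monoid monoid.one_closed group_colored_perm_group)
  show "B_elt n p a x = (if x \<in> shuffle_set n p a then 1 else 0)"
  proof (cases "x \<in> carrier (colored_perm_group n p)")
    case False
    then show ?thesis
      using one by (auto simp: B_elt_def of_words_def shuffle_set_def rat_group_algebra_def)
  next
    case x: True
    define w where "w = word_of n x"
    have w: "w \<in> colored_words n p" using word_in[OF x] by (simp add: w_def)
    have letters: "snd l \<in> {1..n}" if "l \<in> set w" for l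
      using letters_in[OF x] that by (simp add: w_def)
    consider "a = 0" | "0 < a" "a < n" | "0 < a" "a = n" using assms(2) by linarith
    then show ?thesis
    proof cases
      case 1
      have "filter (\<lambda>l. snd l > 0) w = w" using letters by (fastforce simp: filter_id_conv)
      moreover have "x = \<one>\<^bsub>colored_perm_group n p\<^esub> \<longleftrightarrow> w = W_word 0 n"
        using inj_onD[OF inj _ x] one by (metis w_def word_of_one)
      ultimately show ?thesis
        using 1 x by (simp add: B_elt_def rat_group_algebra_def shuffle_set_def w_def[symmetric])
    next
      case 2
      define u where "u = filter (\<lambda>l. \<not> snd l > a) w"
      have large: "snd l > a" if "l \<in> set (W_word a n)" for l
        using that by (auto simp: W_word_def simp del: upt_Suc)
      have shuf: "w \<in> shuffles (word_of a \<alpha>) (W_word a n) \<longleftrightarrow>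
          filter (\<lambda>l. snd l > a) w = W_word a n \<and> u = word_of a \<alpha>"
        (is "?l \<longleftrightarrow> ?r") if "\<alpha> \<in> carrier (colored_perm_group a p)" for \<alpha>
      proof
        have small: "\<not> snd l > a" if "l \<in> set (word_of a \<alpha>)" for l
          using letters_in[OF \<open>\<alpha> \<in> _\<close> that] by simp
        have eqs: "filter (\<lambda>l. snd l > a) (word_of a \<alpha>) = []"
          "filter (\<lambda>l. \<not> snd l > a) (word_of a \<alpha>) = word_of a \<alpha>"
          using small by (simp_all only: filter_empty_conv filter_id_conv not_not ball_simps) blast+
        have eqs': "filter (\<lambda>l. snd l > a) (W_word a n) = W_word a n"
          "filter (\<lambda>l. \<not> snd l > a) (W_word a n) = []"
          using large by (simp_all only: filter_empty_conv filter_id_conv not_not) blast+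
        assume ?l
        \<comment> \<open>Filtering commutes with shuffling, and each of the two filters used
          empties one factor, so a single interleaving is left.\<close>
        then have "filter P w \<in> shuffles (filter P (word_of a \<alpha>)) (filter P (W_word a n))" for P
          by (metis filter_shuffles imageI)
        from this[of "\<lambda>l. snd l > a"] this[of "\<lambda>l. \<not> snd l > a"] show ?r
          unfolding eqs eqs' u_def by simp
      next
        assume ?r
        then show ?l
          using partition_in_shuffles[of w "\<lambda>l. \<not> snd l > a"] by (simp add: u_def)
      qed
      have disj: "set (word_of a \<alpha>) \<inter> set (W_word a n) = {}"
        if "\<alpha> \<in> carrier (colored_perm_group a p)" for \<alpha>
        using letters_in[OF that] large by fastforce
      have "B_elt n p a x = (\<Sum>\<alpha>\<in>carrier (colored_perm_group a p).
          of_nat (count (shuffle_product (word_of a \<alpha>) (W_word a n)) w))"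
        using 2 x by (simp add: B_elt_def of_words_def count_sum w_def)
      also have "\<dots> = (\<Sum>\<alpha>\<in>carrier (colored_perm_group a p).
          if filter (\<lambda>l. snd l > a) w = W_word a n \<and> u = word_of a \<alpha> then 1 else 0)"
        by (intro sum.cong refl) (simp add: count_shuffle_product_disjoint disj shuf)
      also have "\<dots> = (if filter (\<lambda>l. snd l > a) w = W_word a n then 1 else 0)"
      \<comment> \<open>If the large letters form \<open>W_word a n\<close>, the remaining
        \<open>a\<close> letters carry exactly the values \<open>{1..a}\<close>. So \<open>u\<close>
        is the word of a unique \<open>\<beta>\<close>, and one summand survives.\<close>
      proof (cases "filter (\<lambda>l. snd l > a) w = W_word a n")
        case True
        have "length w = length (filter (\<lambda>l. snd l > a) w) + length u"
          by (simp add: u_def sum_length_filter_compl)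
        then have "length u = a"
          using w 2 by (auto simp: True W_word_def colored_words_def simp del: upt_Suc)
        moreover have "snd ` set u = {1..a}"
        proof -
          have "snd ` set u = {i \<in> snd ` set w. \<not> i > a}" by (auto simp: u_def)
          also have "\<dots> = {1..a}" using w 2 by (auto simp: colored_words_def)
          finally show ?thesis .
        qed
        moreover have "fst ` set u \<subseteq> {0..<int p}"
          using w by (auto simp: u_def colored_words_def)
        ultimately have "u \<in> colored_words a p" by (simp add: colored_words_def)
        then obtain \<beta> where "\<beta> \<in> carrier (colored_perm_group a p)" "u = word_of a \<beta>"
          using bij_betw_imp_surj_on[OF bij_betw_word_of[OF assms(1)]] by blast
        moreover from this have "u = word_of a \<alpha> \<longleftrightarrow> \<beta> = \<alpha>"
          if "\<alpha> \<in> carrier (colored_perm_group a p)" for \<alpha>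
          using inj_onD[OF inj] that by metis
        ultimately show ?thesis using True fin by simp
      qed simp
      finally show ?thesis using x by (simp add: shuffle_set_def w_def)
    next
      case 3
      have "B_elt n p a x = (\<Sum>\<alpha>\<in>carrier (colored_perm_group n p). if \<alpha> = x then 1 else 0)"
        using 3 x by (simp add: B_elt_def of_words_def count_sum)
          (intro sum.cong refl, simp add: inj_on_eq_iff[OF inj _ x])
      also have "\<dots> = 1" using x fin by simp
      finally have "B_elt n p a x = 1" .
      moreover have "\<not> snd l > a" if "l \<in> set w" for l
        using letters[OF that] 3 by simp
      then have "filter (\<lambda>l. snd l > a) w = []" by (simp only: filter_empty_conv) blast
      ultimately show ?thesis using 3 x by (simp add: shuffle_set_def W_word_def w_def)
    qed
  qed
qed

section \<open>Multiplication by \<open>B\<^sub>1\<close>\<close>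

text \<open>Left multiplication by \<open>x\<close> relabels the word of \<open>y\<close>
  injectively and sends the identity word to that of \<open>x\<close>. The condition on
  \<open>y\<close>, that its letters other than the one of value 1 spell \<open>W_word 1 n\<close>,
  is carried over to the product.\<close>

lemma shuffle_set_1_iff:
  assumes "p \<ge> 1" "n \<ge> 1"
    and x: "x \<in> carrier (colored_perm_group n p)" and y: "y \<in> carrier (colored_perm_group n p)"
  shows "y \<in> shuffle_set n p 1 \<longleftrightarrow>
    filter (\<lambda>l. snd l \<noteq> snd (hd (word_of n x))) (word_of n (x \<otimes>\<^bsub>colored_perm_group n p\<^esub> y)) =
      tl (word_of n x)"
proof -
  interpret G: group "colored_perm_group n p" by (rule group_colored_perm_group)
  let ?L = "{0..<int p} \<times> {1..n}"
  have word_x: "word_of n x = map (relabel p x) (W_word 0 n)"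
    using word_of_mult[OF assms(1) x G.one_closed] x by (simp add: word_of_one)
  then have hd_tl: "hd (word_of n x) = relabel p x (0, 1)"
    "tl (word_of n x) = map (relabel p x) (W_word 1 n)"
    using W_word_Cons[of 0 n] assms(2) by simp_all
  have "word_of n y \<in> colored_words n p"
    using bij_betwE[OF bij_betw_word_of[OF assms(1)]] y by blast
  then have setw: "set (word_of n y) \<subseteq> ?L" by (force simp: colored_words_def)
  have "snd (relabel p x l) = snd (relabel p x (0, 1)) \<longleftrightarrow> snd l = 1" for l
    using x permutes_inj[of "snd x" "{1..n}"]
    by (auto simp: relabel_def case_prod_unfold carrier_colored_perm_group[OF assms(1)] dest: injD)
  moreover have "snd l \<noteq> 1 \<longleftrightarrow> snd l > 1" if "l \<in> set (word_of n y)" for l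
    using that setw by fastforce
  ultimately have "filter (\<lambda>l. snd l \<noteq> snd (hd (word_of n x)))
        (word_of n (x \<otimes>\<^bsub>colored_perm_group n p\<^esub> y)) =
      map (relabel p x) (filter (\<lambda>l. snd l > 1) (word_of n y))"
    unfolding word_of_mult[OF assms(1) x y] filter_map hd_tl o_def
    by (intro arg_cong[where f = "map _"] filter_cong) auto
  \<comment> \<open>Injectivity on the letters of both words allows \<open>map (relabel p x)\<close>
    to be cancelled from the equation.\<close>
  moreover have "inj_on (relabel p x) (set (filter (\<lambda>l. snd l > 1) (word_of n y)) \<union> set (W_word 1 n))"
    using setw assms(1)
    by (intro inj_on_subset[OF inj_on_relabel[OF assms(1) x]])
      (auto simp: W_word_def simp del: upt_Suc)
  ultimately show ?thesis
    using y by (simp add: hd_tl inj_on_map_eq_map shuffle_set_def)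
qed

text \<open>
  Right multiplication by \<open>B\<^sub>1\<close> moves the first letter anywhere, with a new color. So a factorization
  of \<open>z\<close> is determined by the first letter of its left factor \<open>x\<close>: the rest of the word of \<open>x\<close> is the
  word of \<open>z\<close> without that letter.
\<close>

lemma bij_betw_factorizations:
  assumes "p \<ge> 1" "n \<ge> 1" and z: "z \<in> carrier (colored_perm_group n p)"
  shows "bij_betw (\<lambda>(x, y). hd (word_of n x))
    {(x, y). x \<in> shuffle_set n p a \<and> y \<in> shuffle_set n p 1 \<and> x \<otimes>\<^bsub>colored_perm_group n p\<^esub> y = z}
    {l \<in> {0..<int p} \<times> {1..n}.
      filter (\<lambda>l'. snd l' > a) (l # filter (\<lambda>l'. snd l' \<noteq> snd l) (word_of n z)) = W_word a n}"
    (is "bij_betw ?h ?P ?Q")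
proof -
  interpret G: group "colored_perm_group n p" by (rule group_colored_perm_group)
  note bij = bij_betw_word_of[OF assms(1), of n]
  have carrier: "x \<in> carrier (colored_perm_group n p)" if "x \<in> shuffle_set n p b" for x b
    using that by (simp add: shuffle_set_def)
  have word_x: "word_of n x =
      hd (word_of n x) # filter (\<lambda>l'. snd l' \<noteq> snd (hd (word_of n x))) (word_of n z)"
    if "x \<in> carrier (colored_perm_group n p)" "y \<in> shuffle_set n p 1"
      "x \<otimes>\<^bsub>colored_perm_group n p\<^esub> y = z" for x y
  proof -
    have "word_of n x \<noteq> []" using length_word_of[of n x] assms(2) by fastforce
    then show ?thesis
      using that shuffle_set_1_iff[OF assms(1,2), of x y] carrier by simp
  qed
  show ?thesis
    unfolding bij_betw_def
  proof (intro conjI inj_onI subset_antisym subsetI)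
    fix q q' assume "q \<in> ?P" "q' \<in> ?P" and eq: "?h q = ?h q'"
    then obtain x y x' y' where q: "q = (x, y)" "q' = (x', y')"
      and x: "x \<in> carrier (colored_perm_group n p)" "x' \<in> carrier (colored_perm_group n p)"
      and y: "y \<in> shuffle_set n p 1" "y' \<in> shuffle_set n p 1"
      and xy: "x \<otimes>\<^bsub>colored_perm_group n p\<^esub> y = z" "x' \<otimes>\<^bsub>colored_perm_group n p\<^esub> y' = z"
      using carrier by auto
    have "word_of n x = word_of n x'"
      using word_x[OF x(1) y(1) xy(1)] word_x[OF x(2) y(2) xy(2)] eq by (simp add: q)
    then have "x = x'"
      using inj_onD[OF bij_betw_imp_inj_on[OF bij]] x by blast
    moreover from this have "y = y'"
      using xy x carrier[OF y(1)] carrier[OF y(2)] G.l_cancel by metis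
    ultimately show "q = q'" by (simp add: q)
  next
    fix l assume "l \<in> ?h ` ?P"
    then obtain x y where l: "l = hd (word_of n x)"
      and x: "x \<in> shuffle_set n p a" and y: "y \<in> shuffle_set n p 1"
      and xy: "x \<otimes>\<^bsub>colored_perm_group n p\<^esub> y = z" by auto
    have word: "word_of n x = l # filter (\<lambda>l'. snd l' \<noteq> snd l) (word_of n z)"
      using word_x[OF carrier[OF x] y xy] by (simp add: l)
    then have "l \<in> set (word_of n x)" by simp
    moreover have "word_of n x \<in> colored_words n p"
      using bij_betwE[OF bij] carrier[OF x] by blast
    ultimately have "l \<in> {0..<int p} \<times> {1..n}"
      unfolding colored_words_def mem_Times_iff by blast
    then show "l \<in> ?Q" using x by (simp add: shuffle_set_def word)
  next
    fix l assume l: "l \<in> ?Q"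
    \<comment> \<open>For surjectivity, the word of the left factor is built from that of
      \<open>z\<close>: the letter with the value of \<open>l\<close> is deleted and
      \<open>l\<close> is put in front.\<close>
    define u where "u = l # filter (\<lambda>l'. snd l' \<noteq> snd l) (word_of n z)"
    have w: "word_of n z \<in> colored_words n p" using bij_betwE[OF bij] z by blast
    have snd_u: "snd ` set u = {1..n}"
    proof -
      have "snd ` set u = insert (snd l) (snd ` set (word_of n z))" by (auto simp: u_def)
      also have "\<dots> = {1..n}" using w l by (auto simp: colored_words_def)
      finally show ?thesis .
    qed
    have "distinct (map snd u)"
      using distinct_map_filter[OF distinct_colored_words[OF w]] by (auto simp: u_def)
    then have "length u = n" using distinct_card[of "map snd u"] snd_u by simp
    moreover have "fst ` set u \<subseteq> {0..<int p}"
      using w l by (simp add: u_def colored_words_def) (simp add: image_subset_iff mem_Times_iff)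
    ultimately have "u \<in> colored_words n p"
      unfolding colored_words_def using snd_u by blast
    then have "u \<in> word_of n ` carrier (colored_perm_group n p)"
      by (simp only: bij_betw_imp_surj_on[OF bij])
    then obtain x where x: "x \<in> carrier (colored_perm_group n p)" "word_of n x = u"
      by auto
    \<comment> \<open>The right factor is forced by \<open>x\<close> and \<open>z\<close>; its
      membership in \<open>shuffle_set n p 1\<close> then holds by the construction of
      \<open>u\<close>.\<close>
    define y where "y = inv\<^bsub>colored_perm_group n p\<^esub> x \<otimes>\<^bsub>colored_perm_group n p\<^esub> z"
    have y: "y \<in> carrier (colored_perm_group n p)" using x z by (simp add: y_def)
    have xy: "x \<otimes>\<^bsub>colored_perm_group n p\<^esub> y = z"
      using x z by (simp add: y_def G.m_assoc[symmetric])
    have "y \<in> shuffle_set n p 1"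
      unfolding shuffle_set_1_iff[OF assms(1,2) x(1) y] xy by (simp add: x u_def)
    moreover have "x \<in> shuffle_set n p a" using l x by (simp add: shuffle_set_def u_def)
    ultimately have "(x, y) \<in> ?P" using xy by simp
    then show "l \<in> ?h ` ?P" by (rule rev_image_eqI) (simp add: x u_def)
  qed
qed

text \<open>Possible first letters of the left factor are counted. Those of value at most
  \<open>a\<close> are unconstrained, giving \<open>p * a\<close> choices (\<open>?S\<close>); a
  larger value must open \<open>W_word a n\<close>, which leaves only \<open>(0, Suc a)\<close>
  (\<open>?T\<close>).\<close>

lemma card_factorizations:
  assumes "p \<ge> 1" "n \<ge> 1" "a \<le> n" and z: "z \<in> carrier (colored_perm_group n p)"
  shows "card {(x, y). x \<in> shuffle_set n p a \<and> y \<in> shuffle_set n p 1 \<and>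
      x \<otimes>\<^bsub>colored_perm_group n p\<^esub> y = z} =
    (if z \<in> shuffle_set n p a then p * a else 0) +
    (if a < n \<and> z \<in> shuffle_set n p (Suc a) then 1 else 0)"
proof -
  define w where "w = word_of n z"
  let ?Q = "{l \<in> {0..<int p} \<times> {1..n}.
      filter (\<lambda>l'. snd l' > a) (l # filter (\<lambda>l'. snd l' \<noteq> snd l) w) = W_word a n}"
  let ?S = "if z \<in> shuffle_set n p a then {0..<int p} \<times> {1..a} else {}"
  let ?T = "if a < n \<and> z \<in> shuffle_set n p (Suc a) then {(0 :: int, Suc a)} else {}"
  have mem: "(c, j) \<in> ?Q \<longleftrightarrow> (c, j) \<in> ?S \<union> ?T" for c j
  proof (cases "j \<le> a")
    case True
    \<comment> \<open>Deleting a letter of value at most \<open>a\<close> does not change the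
      subword of larger letters, so the condition concerns \<open>z\<close> alone.\<close>
    then have "(\<lambda>l'. snd l' \<noteq> j \<and> snd l' > a) = (\<lambda>l' :: int \<times> nat. snd l' > a)" by auto
    then show ?thesis
      using True z assms(3) by (auto simp: shuffle_set_def w_def conj_commute)
  next
    case False
    \<comment> \<open>Once the first letter is \<open>(0, Suc a)\<close>, the rest has to spell
      \<open>W_word (Suc a) n\<close>.\<close>
    have "(\<lambda>l'. snd l' \<noteq> Suc a \<and> snd l' > a) = (\<lambda>l' :: int \<times> nat. snd l' > Suc a)" by auto
    then show ?thesis
      using False z assms(1,3) W_word_Cons[of a n]
      by (auto simp: shuffle_set_def w_def conj_commute)
  qed
  have "?Q = ?S \<union> ?T" using mem by (simp only: set_eq_iff split_paired_All) blast
  then have "card ?Q = card (?S \<union> ?T)" by (rule arg_cong)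
  also have "\<dots> = card ?S + card ?T" by (rule card_Un_disjoint) auto
  finally show ?thesis
    using bij_betw_same_card[OF bij_betw_factorizations[OF assms(1,2) z, of a]]
    by (simp add: w_def)
qed

lemma B_elt_closed:
  assumes "p \<ge> 1" "a \<le> n"
  shows "B_elt n p a \<in> carrier (rat_group_algebra (colored_perm_group n p))"
  using finite_colored_perm_group[OF assms(1), of n]
  by (auto simp: B_elt_eq_indicator[OF assms] rat_group_algebra_def shuffle_set_def
      intro: finite_subset)

text \<open>Both factors are indicator functions, so the coefficient at \<open>z\<close> is the
  number of factorizations of \<open>z\<close>.\<close>

lemma B_elt_mult_B_elt_1:
  assumes "p \<ge> 1" "n \<ge> 1" "a \<le> n"
  shows "B_elt n p a \<otimes>\<^bsub>rat_group_algebra (colored_perm_group n p)\<^esub> B_elt n p 1 =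
    (\<lambda>z. of_nat (p * a) * B_elt n p a z + (if a < n then B_elt n p (Suc a) z else 0))"
proof
  fix z
  have sub: "shuffle_set n p b \<subseteq> carrier (colored_perm_group n p)" for b
    by (auto simp: shuffle_set_def)
  let ?P = "{(x, y). x \<in> shuffle_set n p a \<and> y \<in> shuffle_set n p 1 \<and>
      x \<otimes>\<^bsub>colored_perm_group n p\<^esub> y = z}"
  have "(B_elt n p a \<otimes>\<^bsub>rat_group_algebra (colored_perm_group n p)\<^esub> B_elt n p 1) z =
      (\<Sum>(x, y)\<in>{(x, y) \<in> shuffle_set n p a \<times> shuffle_set n p 1.
        x \<otimes>\<^bsub>colored_perm_group n p\<^esub> y = z}. B_elt n p a x * B_elt n p 1 y)"
    using finite_subset[OF sub finite_colored_perm_group[OF assms(1)]] assms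
    by (intro mult_rat_group_algebra) (auto simp: B_elt_eq_indicator)
  also have "\<dots> = (\<Sum>q\<in>?P. 1)"
    using assms by (intro sum.cong) (auto simp: B_elt_eq_indicator)
  also have "\<dots> = of_nat (card ?P)" by simp
  also have "\<dots> = of_nat (p * a) * B_elt n p a z + (if a < n then B_elt n p (Suc a) z else 0)"
  proof (cases "z \<in> carrier (colored_perm_group n p)")
    case True
    show ?thesis
      unfolding card_factorizations[OF assms True] using assms by (simp add: B_elt_eq_indicator)
  next
    case False
    interpret G: group "colored_perm_group n p" by (rule group_colored_perm_group)
    have "?P = {}" using False sub G.m_closed by blast
    moreover have "z \<notin> shuffle_set n p b" for b using False sub by blast
    ultimately show ?thesis
      using assms by (simp only: card.empty) (simp add: B_elt_eq_indicator)
  qed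
  finally show "(B_elt n p a \<otimes>\<^bsub>rat_group_algebra (colored_perm_group n p)\<^esub> B_elt n p 1) z = \<dots>" .
qed

section \<open>The eigenvectors \<open>e\<^sub>i\<close>\<close>

definition e_coeff :: "nat \<Rightarrow> nat \<Rightarrow> nat \<Rightarrow> rat" where
  "e_coeff p i a = (-1) ^ (a - i) / (of_nat p ^ a * fact (a - i) * fact i)"

lemma e_elt_eq_sum:
  assumes "p \<ge> 1"
  shows "e_elt n p i = (\<lambda>x. \<Sum>a\<in>{i..n}. e_coeff p i a * B_elt n p a x)"
proof -
  let ?A = "rat_group_algebra (colored_perm_group n p)"
  have "(\<lambda>a. ((-1) ^ (a - i) / (of_nat p ^ a * fact (a - i))) \<odot>\<^bsub>?A\<^esub> B_elt n p a) \<in>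
      {i..n} \<rightarrow> carrier ?A"
    using B_elt_closed[OF assms] by (simp add: smult_closed_rat_group_algebra)
  then show ?thesis
    by (simp add: e_elt_def Let_def finsum_rat_group_algebra smult_rat_group_algebra
        sum_distrib_left e_coeff_def mult_ac)
qed

lemma e_elt_closed:
  assumes "p \<ge> 1"
  shows "e_elt n p i \<in> carrier (rat_group_algebra (colored_perm_group n p))"
  unfolding e_elt_eq_sum[OF assms]
  by (intro sum_closed_rat_group_algebra B_elt_closed assms) simp

text \<open>This recurrence is what comparing coefficients of \<open>B_elt n p (Suc a)\<close> in
  the eigenvector equation with eigenvalue \<open>p * i\<close> demands.\<close>

lemma e_coeff_Suc:
  assumes "p \<ge> 1" "i \<le> a"
  shows "of_nat p * (of_nat i - of_nat (Suc a)) * e_coeff p i (Suc a) = e_coeff p i a"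
proof -
  obtain d where a: "a = i + d" using assms(2) le_Suc_ex by blast
  have "of_nat i - of_nat (Suc a) = - (of_nat (Suc d) :: rat)" by (simp add: a)
  moreover have "e_coeff p i (Suc a) =
      - ((-1) ^ d / (of_nat p * of_nat p ^ a * (of_nat (Suc d) * fact d) * fact i))"
    by (simp add: e_coeff_def a Suc_diff_le del: of_nat_Suc)
  ultimately have "of_nat p * (of_nat i - of_nat (Suc a)) * e_coeff p i (Suc a) =
      of_nat p * - of_nat (Suc d) *
        - ((-1) ^ d / (of_nat p * of_nat p ^ a * (of_nat (Suc d) * fact d) * fact i))"
    by (simp only:)
  also have "\<dots> = e_coeff p i a"
    using assms(1) by (simp add: e_coeff_def a del: of_nat_Suc)
  finally show ?thesis .
qed

lemma e_elt_mult_B_elt_1: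
  assumes "p \<ge> 1" "n \<ge> 1" "i \<le> n"
  shows "e_elt n p i \<otimes>\<^bsub>rat_group_algebra (colored_perm_group n p)\<^esub> B_elt n p 1 =
    (\<lambda>x. of_nat (p * i) * e_elt n p i x)"
proof
  fix x
  define c where "c = e_coeff p i"
  define b where "b a = B_elt n p a x" for a
  have "(e_elt n p i \<otimes>\<^bsub>rat_group_algebra (colored_perm_group n p)\<^esub> B_elt n p 1) x =
      (\<Sum>a\<in>{i..n}. c a * (B_elt n p a \<otimes>\<^bsub>rat_group_algebra (colored_perm_group n p)\<^esub> B_elt n p 1) x)"
    unfolding e_elt_eq_sum[OF assms(1)] c_def
    by (subst sum_mult_rat_group_algebra) (use assms in \<open>simp_all add: B_elt_closed\<close>)
  also have "\<dots> = (\<Sum>a\<in>{i..n}. c a * (of_nat (p * a) * b a + (if a < n then b (Suc a) else 0)))"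
    by (intro sum.cong refl) (simp only: B_elt_mult_B_elt_1[OF assms(1,2)] b_def atLeastAtMost_iff)
  also have "\<dots> = (\<Sum>a\<in>{i..n}. of_nat (p * a) * c a * b a) + (\<Sum>a\<in>{i..<n}. c a * b (Suc a))"
  proof -
    have "(\<Sum>a\<in>{i..n}. c a * (if a < n then b (Suc a) else 0)) = (\<Sum>a\<in>{i..<n}. c a * b (Suc a))"
      by (rule sum.mono_neutral_cong_right) auto
    then show ?thesis by (simp add: distrib_left sum.distrib mult_ac)
  qed
  \<comment> \<open>The recurrence expresses the shifted terms by the coefficient with the same
    index as \<open>b\<close>, so that after reindexing they combine with the diagonal terms:
    \<open>p * a + p * (i - a) = p * i\<close>.\<close>
  also have "(\<Sum>a\<in>{i..<n}. c a * b (Suc a)) =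
      (\<Sum>a\<in>{i..<n}. of_nat p * (of_nat i - of_nat (Suc a)) * c (Suc a) * b (Suc a))"
    by (intro sum.cong refl) (simp only: c_def e_coeff_Suc[OF assms(1)] atLeastLessThan_iff)
  also have "\<dots> = (\<Sum>a\<in>{Suc i..n}. of_nat p * (of_nat i - of_nat a) * c a * b a)"
    by (rule sum.reindex_bij_witness[of _ "\<lambda>a. a - 1" Suc]) auto
  \<comment> \<open>The added term \<open>a = i\<close> vanishes because of the factor
    \<open>i - a\<close>.\<close>
  also have "\<dots> = (\<Sum>a\<in>{i..n}. of_nat p * (of_nat i - of_nat a) * c a * b a)"
    by (subst sum.atLeast_Suc_atMost[OF assms(3)]) simp
  also have "(\<Sum>a\<in>{i..n}. of_nat (p * a) * c a * b a) + \<dots> = of_nat (p * i) * e_elt n p i x"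
    by (simp add: e_elt_eq_sum[OF assms(1)] sum.distrib[symmetric] sum_distrib_left
        c_def b_def algebra_simps)
  finally show "(e_elt n p i \<otimes>\<^bsub>rat_group_algebra (colored_perm_group n p)\<^esub> B_elt n p 1) x =
      of_nat (p * i) * e_elt n p i x" .
qed

text \<open>For \<open>i\<close> at most \<open>a\<close>, \<open>e_coeff p i a\<close> is the
  signed binomial coefficient \<open>a choose i\<close> divided by \<open>p ^ a * fact a\<close>, so
  the sum is a multiple of an alternating row sum of Pascal's triangle.\<close>

lemma sum_e_coeff:
  assumes "p \<ge> 1"
  shows "(\<Sum>i\<le>a. e_coeff p i a) = (if a = 0 then 1 else 0)"
proof (cases "a = 0")
  case False
  have "(\<Sum>i\<le>a. e_coeff p i a) =
      (\<Sum>i\<le>a. (-1) ^ (a - i) * of_nat (a choose (a - i))) / (of_nat p ^ a * fact a)"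
    unfolding sum_divide_distrib
    by (intro sum.cong refl) (auto simp: e_coeff_def binomial_fact)
  also have "(\<Sum>i\<le>a. (-1) ^ (a - i) * of_nat (a choose (a - i))) =
      (\<Sum>i\<le>a. (-1) ^ i * (of_nat (a choose i) :: rat))"
    by (rule sum.reindex_bij_witness[of _ "\<lambda>i. a - i" "\<lambda>i. a - i"]) auto
  finally show ?thesis using False by (simp add: choose_alternating_sum)
qed (simp add: e_coeff_def)

text \<open>Exchanging the sums makes \<open>sum_e_coeff\<close> the coefficient of
  \<open>B_elt n p a\<close>, so only the unit \<open>B_elt n p 0\<close> remains. This resolves the
  unit into the eigenvectors.\<close>

lemma sum_e_elt:
  assumes "p \<ge> 1"
  shows "(\<Sum>i\<le>n. e_elt n p i x) = B_elt n p 0 x"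
proof -
  have "(\<Sum>i\<le>n. e_elt n p i x) = (\<Sum>a\<le>n. \<Sum>i\<le>a. e_coeff p i a * B_elt n p a x)"
    unfolding e_elt_eq_sum[OF assms] sum.Sigma[OF finite_atMost ballI[OF finite_atLeastAtMost]]
      sum.Sigma[OF finite_atMost ballI[OF finite_atMost]]
    by (rule sum.reindex_bij_witness[of _ prod.swap prod.swap]) auto
  also have "\<dots> = (\<Sum>a\<le>n. if a = 0 then B_elt n p a x else 0)"
    by (intro sum.cong refl) (simp add: sum_distrib_right[symmetric] sum_e_coeff[OF assms])
  finally show ?thesis by simp
qed

theorem theorem4:
  fixes n p k :: nat
  assumes "n \<ge> 1" and "p \<ge> 1"
  defines "A \<equiv> rat_group_algebra (colored_perm_group n p)"
  shows "B_elt n p 1 [^]\<^bsub>A\<^esub> k = (\<Oplus>\<^bsub>A\<^esub>i\<in>{0..n}. (of_nat (p * i)) ^ k \<odot>\<^bsub>A\<^esub> e_elt n p i)"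
proof -
  have "B_elt n p 1 [^]\<^bsub>A\<^esub> k = (\<lambda>x. \<Sum>i\<in>{0..n}. of_nat (p * i) ^ k * e_elt n p i x)"
  proof (induction k)
    case 0
    \<comment> \<open>For exponent 0 every eigenvector has coefficient 1, including
      \<open>i = 0\<close> since \<open>0 ^ 0 = 1\<close>, so the claim is the decomposition of the
      unit.\<close>
    have "B_elt n p 1 [^]\<^bsub>A\<^esub> (0 :: nat) = B_elt n p 0"
      by (simp add: nat_pow_def A_def B_elt_def)
    then show ?case by (simp add: sum_e_elt[OF assms(2)] atLeast0AtMost fun_eq_iff)
  next
    case (Suc k)
    \<comment> \<open>Powers grow by a factor on the right, the side on which the eigenvector
      equation holds.\<close>
    have "B_elt n p 1 [^]\<^bsub>A\<^esub> Suc k = B_elt n p 1 [^]\<^bsub>A\<^esub> k \<otimes>\<^bsub>A\<^esub> B_elt n p 1"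
      by (simp add: nat_pow_def)
    also have "\<dots> = (\<lambda>x. \<Sum>i\<in>{0..n}. of_nat (p * i) ^ k * (e_elt n p i \<otimes>\<^bsub>A\<^esub> B_elt n p 1) x)"
      unfolding Suc.IH unfolding A_def
      by (rule sum_mult_rat_group_algebra) (use assms in \<open>auto simp: e_elt_closed B_elt_closed\<close>)
    also have "\<dots> = (\<lambda>x. \<Sum>i\<in>{0..n}. of_nat (p * i) ^ Suc k * e_elt n p i x)"
      unfolding A_def
      by (intro ext sum.cong refl)
        (simp add: e_elt_mult_B_elt_1[OF assms(2,1)] del: One_nat_def)
    finally show ?case .
  qed
  moreover have "(\<lambda>i. of_nat (p * i) ^ k \<odot>\<^bsub>A\<^esub> e_elt n p i) \<in> {0..n} \<rightarrow> carrier A"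
    using e_elt_closed[OF assms(2)] by (simp add: A_def smult_closed_rat_group_algebra)
  ultimately show ?thesis
    unfolding A_def by (simp add: finsum_rat_group_algebra smult_rat_group_algebra)
qed

end
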